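(* Let $\Sigma$ be a finite alphabet, let $\varepsilon\in(0,1]$, let $0\le\gamma<\delta\le1$, let $d>0$ be real, and let $c$ be an integer with $c>\frac{d}{\delta-\gamma}$. Put $$\beta=\delta-\frac dc,\qquad g=\beta-\gamma>0,\qquad \alpha_{\mathrm{wt}}=1+\frac{4d}{g^2}\bigl(3\gamma+2\log(3|\Sigma|)\bigr).$$ Then there is $n_0$, depending only on $|\Sigma|,\varepsilon,\gamma,\delta,d,c$, such that the following holds for every $n\ge n_0$. Let $\Pi\subseteq\Sigma^n$ and let $T$ be a nonadaptive tester which has average query complexity $d$, rejects every input in $\Pi$ with probability at most $\gamma$, and rejects every input $x\in\Sigma^n$ that is $\varepsilon/2$-far from $\Pi$ with probability at least $\delta$. Then $p=\alpha_{\mathrm{wt}}n^{-1/c}\le1$ and $\Pi$ has a two-sided $p$-sampling $\varepsilon$-tester (which samples every coordinate independently with probability $p$): it accepts every input in $\Pi$ with probability at least $2/3$, and rejects every $x\in\Sigma^n$ that is $\varepsilon$-far from $\Pi$ with probability at least $2/3$. Its expected sample complexity is $\alpha_{\mathrm{wt}}n^{1-1/c}$.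
   Context: $\log$ is the natural logarithm. For $x,y\in\Sigma^n$, $\operatorname{dist}(x,y)=\frac1n|\{i\in[n]:x_i\ne y_i\}|$, and $\operatorname{dist}(x,\Pi)=\min_{y\in\Pi}\operatorname{dist}(x,y)$. The word $x$ is $\varepsilon$-far from $\Pi$ if $\operatorname{dist}(x,\Pi)>\varepsilon$. A deterministic local test is a pair $t=(Q_t,\varphi_t)$ with $Q_t\subseteq[n]$ and $\varphi_t:\Sigma^{Q_t}\to\{0,1\}$, where $\varphi_t=1$ means rejection. A nonadaptive tester $T$ is given by a probability distribution $\mu$ on a finite set (index set) $\mathcal T$ of local tests: it samples $t\sim\mu$, queries the coordinates in $Q_t$, and outputs $\varphi_t(x|_{Q_t})$. Its rejection probability on $x$ is $r_T(x)=\mu(\{t\in\mathcal T:\varphi_t(x|_{Q_t})=1\})$, and its average query complexity is $\mathbb E_{t\sim\mu}|Q_t|$. For $p\in[0,1]$, a $p$-sampling tester receives $(W,x|_W)$, where $W\subseteq[n]$ is the random set containing each coordinate independently with probability $p$, and applies arbitrary post-processing (no running-time bound) to decide whether to accept or reject. Its expected sample complexity is $\mathbb E|W|=pn$. *)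

theory Defs
  imports "HOL-Probability.Probability" "HOL-Probability.Product_PMF"
begin

text \<open>Coordinates are numbered from 0, so \<open>[n]\<close> is \<open>{..<n}\<close>.  A word over the alphabet is an
  extensional function on \<open>{..<n}\<close>, and its restriction to \<open>Q\<close> is \<open>restrict x Q\<close>.\<close>

definition words :: "nat \<Rightarrow> 'a set \<Rightarrow> (nat \<Rightarrow> 'a) set" where
  "words n \<Sigma> = {..<n} \<rightarrow>\<^sub>E \<Sigma>"

definition word_dist :: "nat \<Rightarrow> (nat \<Rightarrow> 'a) \<Rightarrow> (nat \<Rightarrow> 'a) \<Rightarrow> real" where
  "word_dist n x y = real (card {i \<in> {..<n}. x i \<noteq> y i}) / real n"

text \<open>Extended reals, so that the distance to the empty property is \<open>\<infinity>\<close>; over a nonempty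
  set of words the infimum is a minimum, the set being finite.\<close>

definition dist_to :: "nat \<Rightarrow> (nat \<Rightarrow> 'a) \<Rightarrow> (nat \<Rightarrow> 'a) set \<Rightarrow> ereal" where
  "dist_to n x P = (INF y\<in>P. ereal (word_dist n x y))"

definition far :: "nat \<Rightarrow> real \<Rightarrow> (nat \<Rightarrow> 'a) \<Rightarrow> (nat \<Rightarrow> 'a) set \<Rightarrow> bool" where
  "far n \<epsilon> x P \<longleftrightarrow> dist_to n x P > ereal \<epsilon>"

text \<open>A local test \<open>(Q, \<phi>)\<close> rejects \<open>x\<close> iff \<open>\<phi> (restrict x Q)\<close> is true; values of \<open>\<phi>\<close>
  elsewhere play no role.\<close>

type_synonym 'a local_test = "nat set \<times> ((nat \<Rightarrow> 'a) \<Rightarrow> bool)"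

definition nonadaptive_tester :: "nat \<Rightarrow> 'a local_test pmf \<Rightarrow> bool" where
  "nonadaptive_tester n T \<longleftrightarrow>
     finite (set_pmf T) \<and> (\<forall>(Q, \<phi>) \<in> set_pmf T. Q \<subseteq> {..<n})"

definition rejection_prob :: "'a local_test pmf \<Rightarrow> (nat \<Rightarrow> 'a) \<Rightarrow> real" where
  "rejection_prob T x = measure_pmf.prob T {(Q, \<phi>). \<phi> (restrict x Q)}"

definition avg_query_complexity :: "'a local_test pmf \<Rightarrow> real" where
  "avg_query_complexity T = measure_pmf.expectation T (\<lambda>(Q, \<phi>). real (card Q))"

definition random_subset :: "nat \<Rightarrow> real \<Rightarrow> nat set pmf" where
  "random_subset n p =
     map_pmf (\<lambda>b. {i \<in> {..<n}. b i}) (Pi_pmf {..<n} False (\<lambda>_. bernoulli_pmf p))"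

definition expected_sample_complexity :: "nat \<Rightarrow> real \<Rightarrow> real" where
  "expected_sample_complexity n p =
     measure_pmf.expectation (random_subset n p) (\<lambda>W. real (card W))"

text \<open>The post-processing \<open>A\<close> is an arbitrary function of \<open>W\<close> and the restriction of the input
  to \<open>W\<close>; the value true means acceptance.  The bounds on \<open>p\<close> matter because \<^const>\<open>bernoulli_pmf\<close>
  clips its argument to the unit interval.\<close>

definition sampling_tester ::
  "nat \<Rightarrow> 'a set \<Rightarrow> real \<Rightarrow> real \<Rightarrow> (nat \<Rightarrow> 'a) set \<Rightarrow> (nat set \<Rightarrow> (nat \<Rightarrow> 'a) \<Rightarrow> bool) \<Rightarrow> bool" where
  "sampling_tester n \<Sigma> p \<epsilon> P A \<longleftrightarrow>
     0 \<le> p \<and> p \<le> 1 \<and>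
     (\<forall>x\<in>P. measure_pmf.prob (random_subset n p) {W. A W (restrict x W)} \<ge> 2 / 3) \<and>
     (\<forall>x\<in>words n \<Sigma>. far n \<epsilon> x P \<longrightarrow>
        measure_pmf.prob (random_subset n p) {W. \<not> A W (restrict x W)} \<ge> 2 / 3)"

end

theory Submission imports Defs begin

text \<open>Write \<open>N = n\<^bsup>1/c\<^esup>\<close>, so that \<open>p = \<alpha> / N\<close>, and call \<open>D i\<close> the probability that the tester
  queries coordinate \<open>i\<close>; these degrees add up to \<open>d\<close>.  For a level \<open>j < c\<close> the set \<open>H\<close> of
  coordinates of degree more than \<open>d / N\<^sup>j\<close> has at most \<open>N\<^sup>j\<close> elements.  Call a test crowded at
  level \<open>j\<close> if for some \<open>r \<ge> 1\<close> it makes \<open>r\<close> queries of degree in \<open>(d / N\<^bsup>j+r\<^esup>, d / N\<^sup>j]\<close>.  As with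
  cars parking at the last free place before their preferred one, a test is crowded at no more levels
  than it makes queries, so at some level the crowded tests have measure at most \<open>d / c\<close> and can be
  discarded.

  The sampler guesses the input on \<open>H\<close> and estimates the rejection probability of the remaining tests
  by inverse probability weighting of those whose queries outside \<open>H\<close> were all sampled.  Since the
  \<open>m\<close>-th most frequently queried coordinate of an uncrowded test outside \<open>H\<close> has degree at most
  \<open>d / N\<^bsup>j+m\<^esup>\<close>, the correlations between overlapping tests sum to at most
  \<open>d / N\<^sup>j \<cdot> (\<alpha>\<^bsup>-1\<^esup> + \<alpha>\<^bsup>-2\<^esup> + \<dots>) = d / (N\<^sup>j (\<alpha> - 1))\<close>.  For words in the property the correct guess
  passes by Chebyshev's inequality.  For far words, Janson's inequality beats the union bound over the
  at most \<open>|\<Sigma>|\<close>-to-the-\<open>N\<^sup>j\<close> guesses.\<close>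

section \<open>Random subsets\<close>

lemma finite_set_random_subset: "finite (set_pmf (random_subset n p))"
  and set_random_subset: "set_pmf (random_subset n p) \<subseteq> Pow {..<n}"
proof -
  show *: "set_pmf (random_subset n p) \<subseteq> Pow {..<n}"
    by (auto simp: random_subset_def)
  show "finite (set_pmf (random_subset n p))"
    using finite_subset[OF *] by simp
qed

lemma integrable_random_subset [simp, intro]:
  fixes f :: "nat set \<Rightarrow> real"
  shows "integrable (measure_pmf (random_subset n p)) f"
  by (intro integrable_measure_pmf_finite finite_set_random_subset)

text \<open>Exposing the coin of the last coordinate separately drives the inductions on
  \<open>n\<close> below.\<close>

lemma random_subset_Suc:
  "random_subset (Suc n) p =
     bernoulli_pmf p \<bind> (\<lambda>b. map_pmf (\<lambda>W. if b then insert n W else W) (random_subset n p))"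
  (is "_ = ?R")
proof -
  have "random_subset (Suc n) p =
      map_pmf (\<lambda>b. {i \<in> {..<Suc n}. b i}) (map_pmf (\<lambda>(y, f). f(n := y))
        (pair_pmf (bernoulli_pmf p) (Pi_pmf {..<n} False (\<lambda>_. bernoulli_pmf p))))"
    unfolding random_subset_def lessThan_Suc by (subst Pi_pmf_insert) auto
  also have "\<dots> = bernoulli_pmf p \<bind> (\<lambda>b. map_pmf (\<lambda>f. {i \<in> {..<Suc n}. (f(n := b)) i})
       (Pi_pmf {..<n} False (\<lambda>_. bernoulli_pmf p)))"
    by (simp add: pair_pmf_def map_pmf_def bind_assoc_pmf bind_return_pmf)
  also have "\<dots> = ?R"
    unfolding random_subset_def pmf.map_comp o_def
    by (intro bind_pmf_cong map_pmf_cong refl) (auto simp: less_Suc_eq)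
  finally show ?thesis .
qed

lemma expectation_random_subset_Suc:
  fixes f :: "nat set \<Rightarrow> real"
  assumes "0 \<le> p" "p \<le> 1"
  shows "measure_pmf.expectation (random_subset (Suc n) p) f =
     p * measure_pmf.expectation (random_subset n p) (\<lambda>W. f (insert n W)) +
     (1 - p) * measure_pmf.expectation (random_subset n p) f"
  unfolding random_subset_Suc
  by (subst pmf_expectation_bind[of UNIV])
     (use assms in \<open>auto simp: finite_set_random_subset UNIV_bool\<close>)

lemma expectation_random_subset_cong:
  fixes f g :: "nat set \<Rightarrow> real"
  assumes "\<And>W. W \<subseteq> {..<n} \<Longrightarrow> f W = g W"
  shows "measure_pmf.expectation (random_subset n p) f = measure_pmf.expectation (random_subset n p) g"
  using assms set_random_subset[of n p] by (intro integral_cong_AE) (auto simp: AE_measure_pmf_iff)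

lemma expected_sample_complexity_eq:
  assumes "0 \<le> p" "p \<le> 1"
  shows "expected_sample_complexity n p = real n * p"
proof (induction n)
  case 0
  show ?case
    by (simp add: expected_sample_complexity_def random_subset_def)
next
  case (Suc n)
  let ?E = "measure_pmf.expectation (random_subset n p)"
  have "?E (\<lambda>W. real (card (insert n W))) = ?E (\<lambda>W. 1 + real (card W))"
  proof (rule expectation_random_subset_cong)
    fix W assume "W \<subseteq> {..<n}"
    moreover from this have "finite W" "n \<notin> W"
      using finite_subset by auto
    ultimately show "real (card (insert n W)) = 1 + real (card W)" by simp
  qed
  also have "\<dots> = 1 + ?E (\<lambda>W. real (card W))"
    by (subst Bochner_Integration.integral_add) auto
  finally show ?case
    using Suc assms by (simp add: expected_sample_complexity_def expectation_random_subset_Suc algebra_simps)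
qed

text \<open>Induct on \<open>n\<close>, exposing the last coordinate. The product of the two
  averages falls short of the average of the two products by \<open>p * (1 - p)\<close> times the
  drops of \<open>f\<close> and \<open>g\<close> caused by inserting that coordinate. Both drops are
  nonnegative for decreasing functions.\<close>

lemma harris_inequality:
  fixes f g :: "nat set \<Rightarrow> real"
  assumes p: "0 \<le> p" "p \<le> 1" and "antimono f" "antimono g"
  shows "measure_pmf.expectation (random_subset n p) f * measure_pmf.expectation (random_subset n p) g
    \<le> measure_pmf.expectation (random_subset n p) (\<lambda>W. f W * g W)"
  using assms(3,4)
proof (induction n arbitrary: f g)
  case 0
  show ?case by (simp add: random_subset_def)
next
  case (Suc n)
  let ?E = "measure_pmf.expectation (random_subset n p)"
  let ?f = "\<lambda>W. f (insert n W)" and ?g = "\<lambda>W. g (insert n W)"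
  have anti: "antimono ?f" "antimono ?g"
    using Suc.prems by (auto intro!: antimonoI elim!: antimonoD)
  have le: "?E ?f \<le> ?E f" "?E ?g \<le> ?E g"
    using Suc.prems by (auto intro!: integral_mono elim!: antimonoD)
  have "(p * ?E ?f + (1 - p) * ?E f) * (p * ?E ?g + (1 - p) * ?E g) =
     p * (?E ?f * ?E ?g) + (1 - p) * (?E f * ?E g) - p * (1 - p) * ((?E f - ?E ?f) * (?E g - ?E ?g))"
    by (simp add: algebra_simps)
  also have "\<dots> \<le> p * (?E ?f * ?E ?g) + (1 - p) * (?E f * ?E g)"
    using p le by simp
  also have "\<dots> \<le> p * ?E (\<lambda>W. ?f W * ?g W) + (1 - p) * ?E (\<lambda>W. f W * g W)"
    using Suc.IH[OF anti] Suc.IH[OF Suc.prems] p by (intro add_mono mult_left_mono) auto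
  finally show ?case using p by (simp add: expectation_random_subset_Suc)
qed

text \<open>The coins outside \<open>A\<close> are independent of those inside, so conditioning on
  \<open>A \<subseteq> W\<close> amounts to adding \<open>A\<close> to an unconditioned
  sample.\<close>

lemma expectation_superset:
  fixes f :: "nat set \<Rightarrow> real"
  assumes p: "0 \<le> p" "p \<le> 1" and "A \<subseteq> {..<n}"
  shows "measure_pmf.expectation (random_subset n p) (\<lambda>W. of_bool (A \<subseteq> W) * f W) =
    p ^ card A * measure_pmf.expectation (random_subset n p) (\<lambda>W. f (A \<union> W))"
  using assms(3)
proof (induction n arbitrary: A f)
  case 0
  then show ?case by (simp add: random_subset_def)
next
  case (Suc n)
  let ?E = "measure_pmf.expectation (random_subset n p)"
  show ?case
  proof (cases "n \<in> A")
    case False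
    with Suc.prems have A: "A \<subseteq> {..<n}" by (auto simp: less_Suc_eq)
    have "?E (\<lambda>W. of_bool (A \<subseteq> insert n W) * f (insert n W)) =
        p ^ card A * ?E (\<lambda>W. f (insert n (A \<union> W)))"
      using False by (subst Suc.IH[OF A, symmetric]) (auto simp: subset_insert)
    with Suc.IH[OF A, of f] p show ?thesis
      by (simp add: expectation_random_subset_Suc algebra_simps)
  next
    case True
    define A' where "A' = A - {n}"
    have A': "A = insert n A'" "n \<notin> A'" "A' \<subseteq> {..<n}" "finite A'"
      using True Suc.prems finite_subset[OF Suc.prems] by (auto simp: A'_def less_Suc_eq)
    have 1: "?E (\<lambda>W. of_bool (A \<subseteq> W) * f W) = ?E (\<lambda>W. 0)"
      using True by (intro expectation_random_subset_cong) auto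
    have 2: "?E (\<lambda>W. of_bool (A \<subseteq> insert n W) * f (insert n W)) =
        ?E (\<lambda>W. of_bool (A' \<subseteq> W) * f (insert n W))"
      using A' by (intro expectation_random_subset_cong) auto
    have 3: "?E (\<lambda>W. f (A \<union> W)) = ?E (\<lambda>W. f (insert n (A' \<union> W)))" 
      "?E (\<lambda>W. f (A \<union> insert n W)) = ?E (\<lambda>W. f (insert n (A' \<union> W)))"
      using A' by auto
    have card: "card A = Suc (card A')" using A' by simp
    show ?thesis
      unfolding expectation_random_subset_Suc[OF p] 1 2 3 Suc.IH[OF \<open>A' \<subseteq> {..<n}\<close>] card
      by (simp add: algebra_simps)
  qed
qed

corollary expectation_subset_indicator:
  assumes "0 \<le> p" "p \<le> 1" "A \<subseteq> {..<n}"
  shows "measure_pmf.expectation (random_subset n p) (\<lambda>W. of_bool (A \<subseteq> W) :: real) = p ^ card A"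
  using expectation_superset[OF assms, of "\<lambda>_. 1"] by simp

section \<open>Tail bounds for weighted subset counts\<close>

locale weighted_subsets =
  fixes n :: nat and p :: real and I :: "'t set" and w :: "'t \<Rightarrow> real" and L :: "'t \<Rightarrow> nat set"
  assumes p: "0 \<le> p" "p \<le> 1"
    and finite_I: "finite I"
    and w_nonneg: "t \<in> I \<Longrightarrow> 0 \<le> w t"
    and L_subset: "t \<in> I \<Longrightarrow> L t \<subseteq> {..<n}"
begin

abbreviation "E \<equiv> (\<lambda>f :: nat set \<Rightarrow> real. measure_pmf.expectation (random_subset n p) f)"

definition X :: "nat set \<Rightarrow> real" where
  "X W = (\<Sum>t\<in>I. w t * of_bool (L t \<subseteq> W))"

definition nbrs :: "'t \<Rightarrow> 't set" where
  "nbrs t = {u \<in> I. L t \<inter> L u \<noteq> {}}"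

text \<open>The sum over ordered dependent pairs from Janson's inequality. It includes
  \<open>u = t\<close> whenever \<open>L t\<close> is nonempty, so that it bounds the variance as
  well; terms with empty \<open>L t\<close> are constant and do not enter.\<close>

definition \<Delta> :: real where
  "\<Delta> = (\<Sum>t\<in>I. \<Sum>u\<in>nbrs t. w t * w u * p ^ card (L t \<union> L u))"

lemma expectation_X: "E X = (\<Sum>t\<in>I. w t * p ^ card (L t))"
  unfolding X_def
  by (subst Bochner_Integration.integral_sum)
    (auto intro!: sum.cong simp: expectation_subset_indicator[OF p L_subset])

lemma expectation_inter:
  assumes "t \<in> I" "u \<in> I"
  shows "E (\<lambda>W. of_bool (L t \<subseteq> W) * of_bool (L u \<subseteq> W)) = p ^ card (L t \<union> L u)"
proof -
  have "E (\<lambda>W. of_bool (L t \<subseteq> W) * of_bool (L u \<subseteq> W)) = E (\<lambda>W. of_bool (L t \<union> L u \<subseteq> W))"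
    by (intro arg_cong[where f = E]) auto
  then show ?thesis
    using expectation_subset_indicator[OF p, of "L t \<union> L u" n] L_subset assms by simp
qed

text \<open>Disjoint \<open>L t\<close> and \<open>L u\<close> give independent indicators, whose
  covariance vanishes; for all other pairs the subtracted product of expectations is
  discarded.\<close>

lemma variance_X_le: "measure_pmf.variance (random_subset n p) X \<le> \<Delta>"
proof -
  have "E (\<lambda>W. (X W)\<^sup>2) =
      E (\<lambda>W. \<Sum>t\<in>I. \<Sum>u\<in>I. w t * w u * (of_bool (L t \<subseteq> W) * of_bool (L u \<subseteq> W)))"
    unfolding X_def power2_eq_square sum_product by (simp add: mult_ac)
  also have "\<dots> = (\<Sum>t\<in>I. \<Sum>u\<in>I. w t * w u * p ^ card (L t \<union> L u))"
    by (simp add: Bochner_Integration.integral_sum expectation_inter)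
  finally have "measure_pmf.variance (random_subset n p) X =
      (\<Sum>t\<in>I. \<Sum>u\<in>I. w t * w u * p ^ card (L t \<union> L u)) - (E X)\<^sup>2"
    by (subst measure_pmf.variance_eq) auto
  also have "\<dots> = (\<Sum>t\<in>I. \<Sum>u\<in>I. w t * w u * (p ^ card (L t \<union> L u) - p ^ card (L t) * p ^ card (L u)))"
    unfolding expectation_X power2_eq_square sum_product sum_subtractf[symmetric]
    by (simp add: algebra_simps)
  also have "\<dots> \<le> (\<Sum>t\<in>I. \<Sum>u\<in>I. if L t \<inter> L u \<noteq> {} then w t * w u * p ^ card (L t \<union> L u) else 0)"
  proof (intro sum_mono)
    fix t u assume tu: "t \<in> I" "u \<in> I"
    then have fin: "finite (L t)" "finite (L u)"
      using L_subset finite_subset by blast+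
    show "w t * w u * (p ^ card (L t \<union> L u) - p ^ card (L t) * p ^ card (L u))
        \<le> (if L t \<inter> L u \<noteq> {} then w t * w u * p ^ card (L t \<union> L u) else 0)"
      using w_nonneg[OF tu(1)] w_nonneg[OF tu(2)] p fin
      by (auto simp: card_Un_disjoint power_add intro!: mult_left_mono)
  qed
  also have "\<dots> = \<Delta>"
    unfolding \<Delta>_def nbrs_def using finite_I by (simp add: sum.inter_filter)
  finally show ?thesis .
qed

lemma chebyshev_upper:
  assumes "0 < a" "\<Delta> \<le> D"
  shows "measure_pmf.prob (random_subset n p) {W. X W \<ge> E X + a} \<le> D / a\<^sup>2"
proof -
  have "measure_pmf.prob (random_subset n p) {W. X W \<ge> E X + a} \<le>
      measure_pmf.prob (random_subset n p) {W \<in> space (random_subset n p). \<bar>X W - E X\<bar> \<ge> a}"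
    by (intro measure_pmf.finite_measure_mono) auto
  also have "\<dots> \<le> measure_pmf.variance (random_subset n p) X / a\<^sup>2"
    using \<open>0 < a\<close> by (intro measure_pmf.Chebyshev_inequality) auto
  also have "\<dots> \<le> D / a\<^sup>2"
    using variance_X_le assms by (intro divide_right_mono) auto
  finally show ?thesis .
qed

section \<open>Janson's bound for the lower tail\<close>

lemma antimono_exp_sum:
  assumes "J \<subseteq> I" "0 \<le> s"
  shows "antimono (\<lambda>W. exp (- s * (\<Sum>u\<in>J. w u * of_bool (L u \<subseteq> A \<union> W))))"
proof (rule antimonoI)
  fix V W :: "nat set" assume "V \<subseteq> W"
  then have "(\<Sum>u\<in>J. w u * of_bool (L u \<subseteq> A \<union> V)) \<le> (\<Sum>u\<in>J. w u * of_bool (L u \<subseteq> A \<union> W))"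
    using assms w_nonneg by (intro sum_mono mult_left_mono) auto
  then show "exp (- s * (\<Sum>u\<in>J. w u * of_bool (L u \<subseteq> A \<union> W)))
      \<le> exp (- s * (\<Sum>u\<in>J. w u * of_bool (L u \<subseteq> A \<union> V)))"
    using \<open>0 \<le> s\<close> by (simp add: mult_left_mono)
qed

text \<open>Conditioned on \<open>L t \<subseteq> W\<close>, the neighbours of \<open>t\<close> and the other terms contribute decreasing
  functions of \<open>W\<close>, which Harris' inequality decouples; the other terms do not depend on the condition.\<close>

lemma expectation_term_exp_ge:
  assumes t: "t \<in> I" and s: "0 \<le> s"
  shows "(p ^ card (L t) - s * (\<Sum>u\<in>nbrs t. w u * p ^ card (L t \<union> L u))) * E (\<lambda>W. exp (- s * X W))
    \<le> E (\<lambda>W. of_bool (L t \<subseteq> W) * exp (- s * X W))"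
proof -
  define Y where "Y W = (\<Sum>u\<in>nbrs t. w u * of_bool (L u \<subseteq> W))" for W
  define Z where "Z W = (\<Sum>u\<in>I - nbrs t. w u * of_bool (L u \<subseteq> W))" for W
  have nbrs: "nbrs t \<subseteq> I" by (auto simp: nbrs_def)
  have X: "X W = Y W + Z W" for W
    unfolding X_def Y_def Z_def using sum.subset_diff[OF nbrs finite_I] by (simp add: add.commute)
  have Z: "Z (L t \<union> W) = Z W" for W
    unfolding Z_def nbrs_def by (intro sum.cong refl) (auto simp: of_bool_def)
  have Y_nonneg: "0 \<le> Y W" for W
    unfolding Y_def using nbrs w_nonneg by (intro sum_nonneg) auto
  have EY: "p ^ card (L t) * E (\<lambda>W. Y (L t \<union> W)) = (\<Sum>u\<in>nbrs t. w u * p ^ card (L t \<union> L u))"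
  proof -
    have "p ^ card (L t) * E (\<lambda>W. Y (L t \<union> W)) = E (\<lambda>W. of_bool (L t \<subseteq> W) * Y W)"
      using expectation_superset[OF p L_subset[OF t]] by simp
    also have "\<dots> = E (\<lambda>W. \<Sum>u\<in>nbrs t. w u * (of_bool (L t \<subseteq> W) * of_bool (L u \<subseteq> W)))"
      unfolding Y_def sum_distrib_left by (simp add: mult_ac)
    also have "\<dots> = (\<Sum>u\<in>nbrs t. w u * p ^ card (L t \<union> L u))"
      using nbrs t by (auto simp: Bochner_Integration.integral_sum expectation_inter intro!: sum.cong)
    finally show ?thesis .
  qed
  \<comment> \<open>Linearising \<open>exp\<close> replaces the contribution of the neighbours by
    its conditional mean, which \<open>EY\<close> evaluates.\<close>
  have "1 - s * E (\<lambda>W. Y (L t \<union> W)) = E (\<lambda>W. 1 - s * Y (L t \<union> W))"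
    by (subst Bochner_Integration.integral_diff) auto
  also have "\<dots> \<le> E (\<lambda>W. exp (- s * Y (L t \<union> W)))"
    using exp_ge_add_one_self[of "- s * Y _"] by (intro integral_mono) auto
  finally have expY: "1 - s * E (\<lambda>W. Y (L t \<union> W)) \<le> E (\<lambda>W. exp (- s * Y (L t \<union> W)))" .
  have expX: "E (\<lambda>W. exp (- s * X W)) \<le> E (\<lambda>W. exp (- s * Z W))"
    using s Y_nonneg by (intro integral_mono) (auto simp: X mult_left_mono)
  have "(p ^ card (L t) - s * (\<Sum>u\<in>nbrs t. w u * p ^ card (L t \<union> L u))) * E (\<lambda>W. exp (- s * X W))
      = p ^ card (L t) * ((1 - s * E (\<lambda>W. Y (L t \<union> W))) * E (\<lambda>W. exp (- s * X W)))"
    by (simp add: EY[symmetric] algebra_simps)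
  also have "\<dots> \<le> p ^ card (L t) * (E (\<lambda>W. exp (- s * Y (L t \<union> W))) * E (\<lambda>W. exp (- s * Z W)))"
  proof (rule mult_left_mono)
    have "(1 - s * E (\<lambda>W. Y (L t \<union> W))) * E (\<lambda>W. exp (- s * X W))
        \<le> E (\<lambda>W. exp (- s * Y (L t \<union> W))) * E (\<lambda>W. exp (- s * X W))"
      by (intro mult_right_mono expY integral_nonneg) auto
    also have "\<dots> \<le> E (\<lambda>W. exp (- s * Y (L t \<union> W))) * E (\<lambda>W. exp (- s * Z W))"
      by (intro mult_left_mono expX integral_nonneg) auto
    finally show "(1 - s * E (\<lambda>W. Y (L t \<union> W))) * E (\<lambda>W. exp (- s * X W)) \<le> \<dots>" .
  qed (use p in auto)
  also have "\<dots> \<le> p ^ card (L t) * E (\<lambda>W. exp (- s * Y (L t \<union> W)) * exp (- s * Z W))"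
  proof (intro mult_left_mono harris_inequality p)
    show "antimono (\<lambda>W. exp (- s * Y (L t \<union> W)))"
      unfolding Y_def by (rule antimono_exp_sum[OF nbrs s])
    show "antimono (\<lambda>W. exp (- s * Z W))"
      unfolding Z_def using antimono_exp_sum[OF Diff_subset[of I "nbrs t"] s, where A = "{}"] by simp
  qed (use p in auto)
  also have "\<dots> = p ^ card (L t) * E (\<lambda>W. exp (- s * X (L t \<union> W)))"
    by (simp add: X Z exp_add[symmetric] algebra_simps)
  also have "\<dots> = E (\<lambda>W. of_bool (L t \<subseteq> W) * exp (- s * X W))"
    using expectation_superset[OF p L_subset[OF t]] by simp
  finally show ?thesis .
qed

text \<open>A differential inequality: the right-hand side is minus the derivative in
  \<open>s\<close> of the Laplace transform of \<open>X\<close>, so its logarithmic derivative is at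
  most \<open>s * D - E X\<close>. It is the previous bound, weighted by \<open>w t\<close> and
  summed over \<open>t\<close>.\<close>

lemma expectation_X_exp_ge:
  assumes s: "0 \<le> s" and D: "\<Delta> \<le> D"
  shows "(E X - s * D) * E (\<lambda>W. exp (- s * X W)) \<le> E (\<lambda>W. X W * exp (- s * X W))"
proof -
  have "(E X - s * D) * E (\<lambda>W. exp (- s * X W)) \<le> (E X - s * \<Delta>) * E (\<lambda>W. exp (- s * X W))"
    using s D by (intro mult_right_mono integral_nonneg) (auto simp: mult_left_mono)
  also have "\<dots> = (\<Sum>t\<in>I. w t * ((p ^ card (L t) -
      s * (\<Sum>u\<in>nbrs t. w u * p ^ card (L t \<union> L u))) * E (\<lambda>W. exp (- s * X W))))"
    unfolding expectation_X \<Delta>_def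
    by (simp add: sum_distrib_left sum_distrib_right sum_subtractf algebra_simps)
  also have "\<dots> \<le> (\<Sum>t\<in>I. w t * E (\<lambda>W. of_bool (L t \<subseteq> W) * exp (- s * X W)))"
    by (intro sum_mono mult_left_mono expectation_term_exp_ge s w_nonneg)
  also have "\<dots> = E (\<lambda>W. \<Sum>t\<in>I. w t * (of_bool (L t \<subseteq> W) * exp (- s * X W)))"
    by (simp add: Bochner_Integration.integral_sum)
  also have "\<dots> = E (\<lambda>W. X W * exp (- s * X W))"
    by (simp add: X_def sum_distrib_right mult_ac)
  finally show ?thesis .
qed

text \<open>As a finite sum, the expectation can be differentiated term by term in a
  parameter.\<close>

lemma expectation_eq_sum: "E f = (\<Sum>W\<in>set_pmf (random_subset n p). f W * pmf (random_subset n p) W)"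
  by (rule integral_measure_pmf_real) (auto simp: finite_set_random_subset)

lemma expectation_exp_le:
  assumes s: "0 \<le> s" and D: "\<Delta> \<le> D"
  shows "E (\<lambda>W. exp (- s * X W)) \<le> exp (s\<^sup>2 * D / 2 - s * E X)"
proof -
  \<comment> \<open>The second factor is the reciprocal of the claimed bound, so the claim reads
    \<open>h s \<le> h 0\<close>, and \<open>expectation_X_exp_ge\<close> makes the derivative of
    \<open>h\<close> nonpositive.\<close>
  define h where "h s = E (\<lambda>W. exp (- s * X W)) * exp (s * E X - s\<^sup>2 * D / 2)" for s
  have "h s \<le> h 0"
  proof (rule DERIV_nonpos_imp_nonincreasing[OF s])
    fix r :: real assume "0 \<le> r" "r \<le> s"
    have 1: "((\<lambda>r. E (\<lambda>W. exp (- r * X W))) has_field_derivative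
        - E (\<lambda>W. X W * exp (- r * X W))) (at r)"
      unfolding expectation_eq_sum
      by (auto intro!: derivative_eq_intros simp: sum_negf[symmetric] mult_ac)
    have 2: "((\<lambda>r. exp (r * E X - r\<^sup>2 * D / 2)) has_field_derivative
        exp (r * E X - r\<^sup>2 * D / 2) * (E X - r * D)) (at r)"
      by (auto intro!: derivative_eq_intros)
    have "(h has_field_derivative
        ((E X - r * D) * E (\<lambda>W. exp (- r * X W)) - E (\<lambda>W. X W * exp (- r * X W))) *
        exp (r * E X - r\<^sup>2 * D / 2)) (at r)"
      unfolding h_def
      using DERIV_mult[OF 1 2] by (simp add: algebra_simps)
    moreover have "((E X - r * D) * E (\<lambda>W. exp (- r * X W)) - E (\<lambda>W. X W * exp (- r * X W))) *
        exp (r * E X - r\<^sup>2 * D / 2) \<le> 0"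
      using expectation_X_exp_ge[OF \<open>0 \<le> r\<close> D] by (intro mult_nonpos_nonneg) auto
    ultimately show "\<exists>y. (h has_real_derivative y) (at r) \<and> y \<le> 0"
      by blast
  qed
  also have "h 0 = 1" by (simp add: h_def)
  finally have "E (\<lambda>W. exp (- s * X W)) \<le> 1 / exp (s * E X - s\<^sup>2 * D / 2)"
    by (simp add: h_def field_simps)
  also have "\<dots> = exp (s\<^sup>2 * D / 2 - s * E X)"
    by (simp add: exp_diff)
  finally show ?thesis .
qed

theorem janson_inequality:
  assumes a: "0 \<le> a" and D: "\<Delta> \<le> D" "0 < D"
  shows "measure_pmf.prob (random_subset n p) {W. X W \<le> E X - a} \<le> exp (- (a\<^sup>2 / (2 * D)))"
proof -
  \<comment> \<open>This value minimises the exponent \<open>s\<^sup>2 * D / 2 - s * a\<close> left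
    by the exponential Markov inequality.\<close>
  define s where "s = a / D"
  have s: "0 \<le> s" using assms by (simp add: s_def)
  have "measure_pmf.prob (random_subset n p) {W. X W \<le> E X - a} =
      E (indicator {W. X W \<le> E X - a})"
    by simp
  also have "\<dots> \<le> E (\<lambda>W. exp (s * (E X - a)) * exp (- s * X W))"
  proof (intro integral_mono)
    fix W
    have "0 \<le> s * (E X - a - X W)" if "X W \<le> E X - a"
      using that s by simp
    then show "indicator {W. X W \<le> E X - a} W \<le> exp (s * (E X - a)) * exp (- s * X W)"
      by (auto simp: exp_add[symmetric] algebra_simps split: split_indicator)
  qed auto
  also have "\<dots> = exp (s * (E X - a)) * E (\<lambda>W. exp (- s * X W))"
    by simp
  also have "\<dots> \<le> exp (s * (E X - a)) * exp (s\<^sup>2 * D / 2 - s * E X)"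
    by (intro mult_left_mono expectation_exp_le s D) auto
  also have "\<dots> = exp (- (a\<^sup>2 / (2 * D)))"
    using D(2) by (simp add: exp_add[symmetric] s_def field_simps power2_eq_square)
  finally show ?thesis .
qed

end

section \<open>Degree levels of a test\<close>

text \<open>In the parking picture, a query of degree in
  \<open>(\<theta> (k + 1), \<theta> k]\<close> is a car preferring place \<open>k\<close>. Place
  \<open>j\<close> ends up occupied iff, for some \<open>r \<ge> 1\<close>, at least
  \<open>r\<close> cars prefer one of the places from \<open>j\<close> to
  \<open>j + r - 1\<close>.\<close>

definition crowded :: "('i \<Rightarrow> real) \<Rightarrow> (nat \<Rightarrow> real) \<Rightarrow> 'i set \<Rightarrow> nat \<Rightarrow> bool" where
  "crowded D \<theta> Q j \<longleftrightarrow> (\<exists>r\<ge>1. r \<le> card {i \<in> Q. \<theta> (j + r) < D i \<and> D i \<le> \<theta> j})"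

text \<open>Walk up the levels. From a crowded level jump by its witness \<open>q\<close>: the
  window passed holds at most \<open>q\<close> crowded levels and at least \<open>q\<close> queries.
  From an uncrowded level move on by one. The windows are disjoint, so the counts add up.\<close>

lemma card_crowded_le:
  assumes \<theta>: "decseq \<theta>" and "finite Q"
  shows "card {j. j < c \<and> crowded D \<theta> Q j} \<le> card Q"
proof -
  define F where "F j r = {i \<in> Q. \<theta> (j + r) < D i \<and> D i \<le> \<theta> j}" for j r
  have fin: "finite (F j r)" for j r
    using \<open>finite Q\<close> by (auto simp: F_def)
  have F_add: "card (F j (q + r)) = card (F j q) + card (F (j + q) r)" for j q r
  proof -
    have "\<theta> (j + q) \<le> \<theta> j" "\<theta> (j + q + r) \<le> \<theta> (j + q)"
      using \<theta> by (auto intro: decseqD)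
    then have "F j (q + r) = F j q \<union> F (j + q) r" "F j q \<inter> F (j + q) r = {}"
      by (auto simp: F_def add.assoc)
    then show ?thesis
      by (simp add: card_Un_disjoint fin)
  qed
  \<comment> \<open>\<open>K\<close> cannot be fixed as \<open>c - j\<close>, since the last window
    may reach beyond \<open>c\<close>.\<close>
  have "\<exists>K. card {k. j \<le> k \<and> k < c \<and> crowded D \<theta> Q k} \<le> card (F j K)" for j
  proof (induction "c - j" arbitrary: j rule: less_induct)
    case less
    show ?case
    proof (cases "j < c")
      case False
      then have empty: "{k. j \<le> k \<and> k < c \<and> crowded D \<theta> Q k} = {}" by auto
      show ?thesis unfolding empty by simp
    next
      case True
      obtain q where q: "1 \<le> q" "card {k. j \<le> k \<and> k < j + q \<and> crowded D \<theta> Q k} \<le> card (F j q)"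
      proof (cases "crowded D \<theta> Q j")
        case True
        then obtain q where "1 \<le> q" "q \<le> card (F j q)"
          by (auto simp: crowded_def F_def)
        moreover have "card {k. j \<le> k \<and> k < j + q \<and> crowded D \<theta> Q k} \<le> card {j..<j + q}"
          by (intro card_mono) auto
        ultimately show thesis using that[of q] by simp
      next
        case False
        then have empty: "{k. j \<le> k \<and> k < j + 1 \<and> crowded D \<theta> Q k} = {}"
          by (auto simp: le_less_Suc_eq)
        show thesis by (rule that[of 1]) (simp, unfold empty, simp)
      qed
      have "c - (j + q) < c - j" using True q by simp
      from less[OF this] obtain K
        where K: "card {k. j + q \<le> k \<and> k < c \<and> crowded D \<theta> Q k} \<le> card (F (j + q) K)"
        by blast
      have "card {k. j \<le> k \<and> k < c \<and> crowded D \<theta> Q k} \<le>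
          card ({k. j \<le> k \<and> k < j + q \<and> crowded D \<theta> Q k} \<union>
            {k. j + q \<le> k \<and> k < c \<and> crowded D \<theta> Q k})"
        by (intro card_mono) auto
      also have "\<dots> \<le> card {k. j \<le> k \<and> k < j + q \<and> crowded D \<theta> Q k} +
            card {k. j + q \<le> k \<and> k < c \<and> crowded D \<theta> Q k}"
        by (rule card_Un_le)
      also have "\<dots> \<le> card (F j (q + K))"
        using q K by (simp add: F_add)
      finally show ?thesis by blast
    qed
  qed
  from this[of 0] obtain K where "card {k. k < c \<and> crowded D \<theta> Q k} \<le> card (F 0 K)"
    by auto
  also have "\<dots> \<le> card Q"
    using \<open>finite Q\<close> by (intro card_mono) (auto simp: F_def)
  finally show ?thesis .
qed

text \<open>Averaging over the \<open>c\<close> levels: by \<open>card_crowded_le\<close>, the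
  crowded masses of all levels together are at most the average number of queries.\<close>

lemma ex_uncrowded_level:
  fixes \<mu> :: "'t \<Rightarrow> real" and Q :: "'t \<Rightarrow> 'i set"
  assumes I: "finite I" "\<And>t. t \<in> I \<Longrightarrow> 0 \<le> \<mu> t" "\<And>t. t \<in> I \<Longrightarrow> finite (Q t)"
    and \<theta>: "decseq \<theta>" and c: "0 < c"
  shows "\<exists>j<c. (\<Sum>t\<in>I. \<mu> t * of_bool (crowded D \<theta> (Q t) j)) \<le> (\<Sum>t\<in>I. \<mu> t * real (card (Q t))) / real c"
proof (rule ccontr)
  assume "\<not> ?thesis"
  then have less: "(\<Sum>t\<in>I. \<mu> t * real (card (Q t))) / real c < (\<Sum>t\<in>I. \<mu> t * of_bool (crowded D \<theta> (Q t) j))"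
    if "j < c" for j
    using that by force
  have "(\<Sum>t\<in>I. \<mu> t * real (card (Q t))) = (\<Sum>j<c. (\<Sum>t\<in>I. \<mu> t * real (card (Q t))) / real c)"
    using c by simp
  also have "\<dots> < (\<Sum>j<c. \<Sum>t\<in>I. \<mu> t * of_bool (crowded D \<theta> (Q t) j))"
    using c less by (intro sum_strict_mono) auto
  also have "\<dots> = (\<Sum>t\<in>I. \<mu> t * (\<Sum>j<c. of_bool (crowded D \<theta> (Q t) j)))"
    by (subst sum.swap) (simp only: sum_distrib_left)
  also have "\<dots> = (\<Sum>t\<in>I. \<mu> t * real (card {j. j < c \<and> crowded D \<theta> (Q t) j}))"
    by (simp add: Collect_conj_eq lessThan_def)
  also have "\<dots> \<le> (\<Sum>t\<in>I. \<mu> t * real (card (Q t)))"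
    using card_crowded_le[OF \<theta> I(3)] I by (intro sum_mono mult_left_mono) auto
  finally show False by simp
qed

section \<open>Overlaps between tests\<close>

text \<open>Listed by decreasing \<open>D\<close>, the \<open>m\<close>-th element has rank at least
  \<open>m\<close>, ties only raising the exponent, so a geometric series dominates. The induction
  adds an element of least \<open>D\<close>, which has full rank.\<close>

lemma sum_power_rank_le:
  fixes D :: "'i \<Rightarrow> real" and x :: real
  assumes "finite L" and x: "0 \<le> x" "x < 1"
  shows "(\<Sum>i\<in>L. x ^ card {k \<in> L. D i \<le> D k}) \<le> x / (1 - x)"
proof -
  have "(\<Sum>i\<in>L. x ^ card {k \<in> L. D i \<le> D k}) \<le> (\<Sum>m<card L. x ^ Suc m)"
    using \<open>finite L\<close>
  proof (induction L rule: finite_ranking_induct[where f = "\<lambda>i. - D i"])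
    case (insert i S)
    show ?case
    proof (cases "i \<in> S")
      case True
      then show ?thesis using insert by (simp add: insert_absorb)
    next
      case False
      have "{k \<in> insert i S. D i \<le> D k} = insert i S"
        using insert by auto
      moreover have "(\<Sum>l\<in>S. x ^ card {k \<in> insert i S. D l \<le> D k}) \<le> (\<Sum>l\<in>S. x ^ card {k \<in> S. D l \<le> D k})"
        using x \<open>finite S\<close> by (intro sum_mono power_decreasing card_mono) auto
      ultimately show ?thesis
        using insert False by simp
    qed
  qed simp
  also have "\<dots> = x * (\<Sum>m<card L. x ^ m)"
    by (simp add: sum_distrib_left)
  also have "\<dots> \<le> x * (1 / (1 - x))"
  proof (rule mult_left_mono)
    show "(\<Sum>m<card L. x ^ m) \<le> 1 / (1 - x)"
      using x by (subst sum_gp_strict) (auto simp: divide_simps)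
  qed (use x in auto)
  finally show ?thesis by simp
qed

text \<open>The common part of \<open>S\<close> and \<open>L u\<close> has at most as many elements as the rank of its element of
  least degree; charging \<open>u\<close> to that element keeps the sum geometric instead of ranging over all
  subsets of \<open>S\<close>.\<close>

lemma overlap_weight_le:
  fixes \<mu> :: "'t \<Rightarrow> real" and D :: "'i \<Rightarrow> real"
  assumes "finite G" and \<mu>: "\<And>u. u \<in> G \<Longrightarrow> 0 \<le> \<mu> u"
    and "finite S" and p: "0 < p" "p \<le> 1"
    and D: "\<And>i. i \<in> S \<Longrightarrow> (\<Sum>u\<in>{u \<in> G. i \<in> L u}. \<mu> u) \<le> D i"
    and rank: "\<And>i. i \<in> S \<Longrightarrow> D i \<le> b * (x * p) ^ card {k \<in> S. D i \<le> D k}"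
    and x: "0 \<le> x" "x < 1" and b: "0 \<le> b"
  shows "(\<Sum>u\<in>{u \<in> G. S \<inter> L u \<noteq> {}}. \<mu> u / p ^ card (S \<inter> L u)) \<le> b * (x / (1 - x))"
proof -
  define m where "m i = card {k \<in> S. D i \<le> D k}" for i
  have "(\<Sum>u\<in>{u \<in> G. S \<inter> L u \<noteq> {}}. \<mu> u / p ^ card (S \<inter> L u)) \<le>
      (\<Sum>u\<in>{u \<in> G. S \<inter> L u \<noteq> {}}. \<Sum>i\<in>S. of_bool (i \<in> L u) * (\<mu> u / p ^ m i))"
  proof (rule sum_mono)
    fix u assume u: "u \<in> {u \<in> G. S \<inter> L u \<noteq> {}}"
    have "finite (S \<inter> L u)" using \<open>finite S\<close> by simp
    then obtain i where i: "i \<in> S \<inter> L u" "\<And>k. k \<in> S \<inter> L u \<Longrightarrow> D i \<le> D k"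
      using u arg_min_if_finite(1)[of "S \<inter> L u" D] arg_min_least[of "S \<inter> L u" _ D] by blast
    have "card (S \<inter> L u) \<le> m i"
      unfolding m_def using i \<open>finite S\<close> by (intro card_mono) auto
    then have "\<mu> u / p ^ card (S \<inter> L u) \<le> \<mu> u / p ^ m i"
      using p \<mu> u by (intro divide_left_mono power_decreasing) auto
    also have "\<dots> = of_bool (i \<in> L u) * (\<mu> u / p ^ m i)"
      using i by simp
    also have "\<dots> \<le> (\<Sum>i\<in>S. of_bool (i \<in> L u) * (\<mu> u / p ^ m i))"
      using i \<open>finite S\<close> p \<mu> u by (intro member_le_sum) auto
    finally show "\<mu> u / p ^ card (S \<inter> L u) \<le> (\<Sum>i\<in>S. of_bool (i \<in> L u) * (\<mu> u / p ^ m i))" .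
  qed
  also have "\<dots> \<le> (\<Sum>u\<in>G. \<Sum>i\<in>S. of_bool (i \<in> L u) * (\<mu> u / p ^ m i))"
    using \<open>finite G\<close> p \<mu> by (intro sum_mono2 sum_nonneg) auto
  also have "\<dots> = (\<Sum>i\<in>S. (\<Sum>u\<in>{u \<in> G. i \<in> L u}. \<mu> u) / p ^ m i)"
    by (subst sum.swap)
      (auto simp: sum_divide_distrib sum.inter_filter[OF \<open>finite G\<close>] intro!: sum.cong)
  \<comment> \<open>The factor \<open>p ^ m i\<close> in the degree bound cancels the inverse
    probability.\<close>
  also have "\<dots> \<le> (\<Sum>i\<in>S. b * x ^ m i)"
  proof (rule sum_mono)
    fix i assume i: "i \<in> S"
    have "(\<Sum>u\<in>{u \<in> G. i \<in> L u}. \<mu> u) \<le> b * x ^ m i * p ^ m i"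
      using D[OF i] rank[OF i] by (simp add: m_def power_mult_distrib mult.assoc)
    then show "(\<Sum>u\<in>{u \<in> G. i \<in> L u}. \<mu> u) / p ^ m i \<le> b * x ^ m i"
      using p by (simp add: divide_le_eq)
  qed
  also have "\<dots> \<le> b * (x / (1 - x))"
    unfolding m_def sum_distrib_left[symmetric]
    by (intro mult_left_mono sum_power_rank_le assms)
  finally show ?thesis .
qed

section \<open>The sampling tester\<close>

lemma rejection_prob_eq_sum:
  assumes "finite (set_pmf T)"
  shows "rejection_prob T x = (\<Sum>t\<in>set_pmf T. pmf T t * of_bool (snd t (restrict x (fst t))))"
proof -
  have "rejection_prob T x = measure_pmf.expectation T (indicator {(Q, \<phi>). \<phi> (restrict x Q)})"
    unfolding rejection_prob_def by simp
  also have "\<dots> = (\<Sum>t\<in>set_pmf T. indicator {(Q, \<phi>). \<phi> (restrict x Q)} t * pmf T t)"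
    using assms by (intro integral_measure_pmf_real) auto
  also have "\<dots> = (\<Sum>t\<in>set_pmf T. pmf T t * of_bool (snd t (restrict x (fst t))))"
    by (intro sum.cong) (auto simp: indicator_def case_prod_beta)
  finally show ?thesis .
qed

lemma avg_query_complexity_eq_sum:
  assumes "finite (set_pmf T)"
  shows "avg_query_complexity T = (\<Sum>t\<in>set_pmf T. pmf T t * real (card (fst t)))"
  unfolding avg_query_complexity_def
  by (subst integral_measure_pmf_real[OF assms]) (auto simp: case_prod_beta mult.commute)

definition patch :: "nat set \<Rightarrow> (nat \<Rightarrow> 'a) \<Rightarrow> (nat \<Rightarrow> 'a) \<Rightarrow> nat \<Rightarrow> 'a" where
  "patch H z x = (\<lambda>i. if i \<in> H then z i else x i)"

text \<open>Here the gap between \<open>\<epsilon>\<close> and \<open>\<epsilon> / 2\<close> is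
  spent: any guess on \<open>H\<close>, right or wrong, changes distances by at most
  \<open>\<epsilon> / 2\<close>.\<close>

lemma far_patch:
  assumes far: "far n \<epsilon> x P" and H: "finite H" "real (card H) \<le> \<epsilon> / 2 * real n" and "0 < n"
  shows "far n (\<epsilon> / 2) (patch H z x) P"
proof -
  \<comment> \<open>A real number strictly in between keeps the inequality strict under the infimum,
    also when \<open>P\<close> is empty and the distance is infinite.\<close>
  obtain e where e: "ereal \<epsilon> < e" "e < dist_to n x P"
    using far dense unfolding far_def by blast
  obtain r where r: "\<epsilon> < r" "ereal r < dist_to n x P"
    using e by (cases e) auto
  have "ereal (r - \<epsilon> / 2) \<le> dist_to n (patch H z x) P"
    unfolding dist_to_def
  proof (rule INF_greatest)
    fix y assume "y \<in> P"
    then have "ereal r < ereal (word_dist n x y)"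
      using r(2) unfolding dist_to_def by (meson INF_lower less_le_trans)
    moreover have "word_dist n x y \<le> word_dist n (patch H z x) y + \<epsilon> / 2"
    proof -
      have "card {i \<in> {..<n}. x i \<noteq> y i} \<le> card ({i \<in> {..<n}. patch H z x i \<noteq> y i} \<union> H)"
        using H by (intro card_mono) (auto simp: patch_def)
      also have "\<dots> \<le> card {i \<in> {..<n}. patch H z x i \<noteq> y i} + card H"
        by (rule card_Un_le)
      finally have "real (card {i \<in> {..<n}. x i \<noteq> y i}) \<le>
          real (card {i \<in> {..<n}. patch H z x i \<noteq> y i}) + \<epsilon> / 2 * real n"
        using H by linarith
      then have "real (card {i \<in> {..<n}. x i \<noteq> y i}) / real n \<le>
          (real (card {i \<in> {..<n}. patch H z x i \<noteq> y i}) + \<epsilon> / 2 * real n) / real n"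
        by (intro divide_right_mono) auto
      then show ?thesis
        using \<open>0 < n\<close> by (simp add: word_dist_def add_divide_distrib)
    qed
    ultimately show "ereal (r - \<epsilon> / 2) \<le> ereal (word_dist n (patch H z x) y)"
      by simp
  qed
  moreover have "ereal (\<epsilon> / 2) < ereal (r - \<epsilon> / 2)" using r by simp
  ultimately show ?thesis
    unfolding far_def by (rule less_le_trans[rotated])
qed

text \<open>The sampled word is undefined outside \<open>W\<close>, but a test whose queries outside
  \<open>H\<close> were all sampled sees no difference.\<close>

lemma restrict_patch:
  assumes "Q - H \<subseteq> W"
  shows "restrict (patch H z (restrict x W)) Q = restrict (patch H z x) Q"
  using assms by (intro restrict_ext) (auto simp: patch_def)

text \<open>The sampler is analysed for arbitrary \<open>G\<close> and \<open>H\<close>. The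
  hypotheses \<open>chebyshev\<close> and \<open>union\<close> bound its error on \<open>P\<close>
  and on far words respectively.\<close>

lemma sampling_tester_if_overlap_le:
  fixes T :: "'a local_test pmf" and G :: "'a local_test set" and H :: "nat set"
  defines "L \<equiv> \<lambda>t :: 'a local_test. fst t - H"
  defines "rej \<equiv> \<lambda>y. \<Sum>t\<in>G. pmf T t * of_bool (snd t (restrict y (fst t)))"
  assumes n: "0 < n" and p01: "0 < p" "p \<le> 1" and finite: "finite \<Sigma>" and P: "P \<subseteq> words n \<Sigma>"
    and T: "nonadaptive_tester n T" and G: "G \<subseteq> set_pmf T"
    and H: "H \<subseteq> {..<n}" "real (card H) \<le> \<epsilon> / 2 * real n"
    and overlap: "\<And>t. t \<in> G \<Longrightarrow>
      (\<Sum>u\<in>{u \<in> G. L t \<inter> L u \<noteq> {}}. pmf T u / p ^ card (L t \<inter> L u)) \<le> B"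
    and complete: "\<And>x. x \<in> P \<Longrightarrow> rej x \<le> \<gamma>"
    and sound: "\<And>x. x \<in> words n \<Sigma> \<Longrightarrow> far n (\<epsilon> / 2) x P \<Longrightarrow> \<gamma> + g \<le> rej x"
    and B: "0 < B" and g: "0 < g"
    and chebyshev: "4 * (\<gamma> * B) / g\<^sup>2 \<le> 1 / 3"
    and union: "real (card \<Sigma> ^ card H) * exp (- (g\<^sup>2 / (8 * B))) \<le> 1 / 3"
  shows "\<exists>A. sampling_tester n \<Sigma> p \<epsilon> P A"
proof -
  have finG: "finite G"
    using T G finite_subset unfolding nonadaptive_tester_def by blast
  have Q: "fst t \<subseteq> {..<n}" if "t \<in> G" for t
    using T G that unfolding nonadaptive_tester_def by fastforce
  have finH: "finite H" using H(1) finite_subset by blast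
  have finL: "finite (L t)" if "t \<in> G" for t
    using Q[OF that] finite_subset unfolding L_def by blast
  \<comment> \<open>\<open>p ^ card (L t)\<close> is the probability that \<open>L t\<close> is
    sampled, so \<open>X y\<close> is an unbiased estimator of \<open>rej y\<close>.\<close>
  define w where "w y t = pmf T t * of_bool (snd t (restrict y (fst t))) / p ^ card (L t)" for y t
  interpret weighted_subsets n p G "w y" L for y
  proof
    show "0 \<le> p" "p \<le> 1" "finite G" using p01 finG by auto
    show "0 \<le> w y t" for t using p01 by (simp add: w_def)
    show "L t \<subseteq> {..<n}" if "t \<in> G" for t using Q[OF that] by (auto simp: L_def)
  qed
  have EX: "E (X y) = rej y" for y
    unfolding expectation_X rej_def w_def using p01 by (intro sum.cong) simp_all
  \<comment> \<open>The rejection indicator is kept for \<open>t\<close> and dropped for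
    \<open>u\<close>, which leaves the factor \<open>rej y\<close>.\<close>
  have \<Delta>: "\<Delta> y \<le> rej y * B" for y
  proof -
    have "\<Delta> y \<le> (\<Sum>t\<in>G. pmf T t * of_bool (snd t (restrict y (fst t))) *
        (\<Sum>u\<in>nbrs t. pmf T u / p ^ card (L t \<inter> L u)))"
      unfolding \<Delta>_def sum_distrib_left
    proof (intro sum_mono)
      fix t u assume t: "t \<in> G" and "u \<in> nbrs t"
      then have u: "u \<in> G" by (auto simp: nbrs_def)
      have "card (L t \<union> L u) + card (L t \<inter> L u) = card (L t) + card (L u)"
        using card_Un_Int[OF finL[OF t] finL[OF u]] by simp
      then have "p ^ card (L t \<union> L u) * p ^ card (L t \<inter> L u) = p ^ card (L t) * p ^ card (L u)"
        by (simp add: power_add[symmetric])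
      then have ratio: "p ^ card (L t \<union> L u) / (p ^ card (L t) * p ^ card (L u)) = 1 / p ^ card (L t \<inter> L u)"
        using p01 by (simp add: field_simps)
      have "w y t * w y u * p ^ card (L t \<union> L u) =
          pmf T t * of_bool (snd t (restrict y (fst t))) *
          (pmf T u * of_bool (snd u (restrict y (fst u)))) *
          (p ^ card (L t \<union> L u) / (p ^ card (L t) * p ^ card (L u)))"
        unfolding w_def by simp
      then have "w y t * w y u * p ^ card (L t \<union> L u) =
          pmf T t * of_bool (snd t (restrict y (fst t))) *
          (pmf T u * of_bool (snd u (restrict y (fst u)))) * (1 / p ^ card (L t \<inter> L u))"
        unfolding ratio .
      also have "\<dots> \<le> pmf T t * of_bool (snd t (restrict y (fst t))) * (pmf T u / p ^ card (L t \<inter> L u))"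
        using p01 by auto
      finally show "w y t * w y u * p ^ card (L t \<union> L u) \<le>
        pmf T t * of_bool (snd t (restrict y (fst t))) * (pmf T u / p ^ card (L t \<inter> L u))" .
    qed
    also have "\<dots> \<le> (\<Sum>t\<in>G. pmf T t * of_bool (snd t (restrict y (fst t))) * B)"
      unfolding nbrs_def by (intro sum_mono mult_left_mono overlap) auto
    finally show ?thesis by (simp add: rej_def sum_distrib_right)
  qed
  \<comment> \<open>On \<open>P\<close> the factor \<open>rej y\<close> is at most \<gamma>; for far
    words this trivial bound is used, giving \<open>D = B\<close> in Janson's inequality.\<close>
  have rej_le_1: "rej y \<le> 1" for y
  proof -
    have "rej y \<le> (\<Sum>t\<in>G. pmf T t)"
      unfolding rej_def by (intro sum_mono) auto
    also have "\<dots> = measure_pmf.prob T G"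
      using finG by (simp add: measure_measure_pmf_finite)
    finally show ?thesis using measure_pmf.prob_le_1[of T G] by linarith
  qed
  \<comment> \<open>Accept iff some guess \<open>z\<close> on \<open>H\<close> brings the estimate
    below the midpoint of \<gamma> and \<open>\<gamma> + g\<close>.\<close>
  define A where "A W u = (\<exists>z \<in> H \<rightarrow>\<^sub>E \<Sigma>. X (patch H z u) W < \<gamma> + g / 2)" for W u
  have A: "A W (restrict x W) \<longleftrightarrow> (\<exists>z \<in> H \<rightarrow>\<^sub>E \<Sigma>. X (patch H z x) W < \<gamma> + g / 2)" for W x
  proof -
    have "X (patch H z (restrict x W)) W = X (patch H z x) W" for z
      unfolding X_def by (intro sum.cong refl) (auto simp: w_def L_def restrict_patch)
    then show ?thesis by (simp add: A_def)
  qed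
  have "sampling_tester n \<Sigma> p \<epsilon> P A"
    unfolding sampling_tester_def
  proof (intro conjI ballI impI)
    show "0 \<le> p" "p \<le> 1" using p01 by auto
  next
    fix x assume x: "x \<in> P"
    \<comment> \<open>The correct guess is the input itself on \<open>H\<close>.\<close>
    have xH: "restrict x H \<in> H \<rightarrow>\<^sub>E \<Sigma>" "patch H (restrict x H) x = x"
      using x P H(1) by (auto simp: words_def patch_def PiE_iff subset_iff)
    have sub: "{W. \<not> A W (restrict x W)} \<subseteq> {W. X x W \<ge> E (X x) + g / 2}"
    proof (intro subsetI CollectI)
      fix W assume "W \<in> {W. \<not> A W (restrict x W)}"
      then have "\<not> X (patch H (restrict x H) x) W < \<gamma> + g / 2"
        using xH(1) unfolding A by blast
      then show "E (X x) + g / 2 \<le> X x W"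
        using complete[OF x] unfolding EX xH(2) by linarith
    qed
    have "\<Delta> x \<le> \<gamma> * B"
      using \<Delta>[of x] mult_right_mono[OF complete[OF x], of B] B by linarith
    then have "measure_pmf.prob (random_subset n p) {W. X x W \<ge> E (X x) + g / 2} \<le> \<gamma> * B / (g / 2)\<^sup>2"
      using g by (intro chebyshev_upper) auto
    also have "\<dots> \<le> 1 / 3" using chebyshev by (simp add: power_divide mult_ac)
    finally have "measure_pmf.prob (random_subset n p) {W. \<not> A W (restrict x W)} \<le> 1 / 3"
      using measure_pmf.finite_measure_mono[OF sub, of "random_subset n p"] by simp
    then show "2 / 3 \<le> measure_pmf.prob (random_subset n p) {W. A W (restrict x W)}"
      using measure_pmf.prob_compl[of "{W. A W (restrict x W)}" "random_subset n p"]
      by (simp add: Compl_eq_Diff_UNIV[symmetric] Collect_neg_eq)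
  next
    fix x assume x: "x \<in> words n \<Sigma>" and far: "far n \<epsilon> x P"
    have z: "\<gamma> + g \<le> rej (patch H z x)" if "z \<in> H \<rightarrow>\<^sub>E \<Sigma>" for z
    proof (rule sound)
      show "patch H z x \<in> words n \<Sigma>"
        using x that H(1) by (auto simp: words_def patch_def PiE_iff extensional_def)
      show "far n (\<epsilon> / 2) (patch H z x) P"
        by (rule far_patch[OF far finH H(2) n])
    qed
    have fin: "finite (H \<rightarrow>\<^sub>E \<Sigma>)" using finH finite by (intro finite_PiE) auto
    have "measure_pmf.prob (random_subset n p) {W. A W (restrict x W)} \<le>
        measure_pmf.prob (random_subset n p) (\<Union>z\<in>H \<rightarrow>\<^sub>E \<Sigma>. {W. X (patch H z x) W \<le> E (X (patch H z x)) - g / 2})"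
    proof (intro measure_pmf.finite_measure_mono subsetI)
      fix W assume "W \<in> {W. A W (restrict x W)}"
      then obtain z where "z \<in> H \<rightarrow>\<^sub>E \<Sigma>" "X (patch H z x) W < \<gamma> + g / 2"
        by (auto simp: A)
      moreover from z[OF this(1)] this(2) have "X (patch H z x) W \<le> E (X (patch H z x)) - g / 2"
        unfolding EX by linarith
      ultimately show "W \<in> (\<Union>z\<in>H \<rightarrow>\<^sub>E \<Sigma>. {W. X (patch H z x) W \<le> E (X (patch H z x)) - g / 2})"
        by blast
    qed auto
    also have "\<dots> \<le> (\<Sum>z\<in>H \<rightarrow>\<^sub>E \<Sigma>. measure_pmf.prob (random_subset n p)
        {W. X (patch H z x) W \<le> E (X (patch H z x)) - g / 2})"
      using fin by (intro measure_pmf.finite_measure_subadditive_finite) auto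
    also have "\<dots> \<le> (\<Sum>z\<in>H \<rightarrow>\<^sub>E \<Sigma>. exp (- ((g / 2)\<^sup>2 / (2 * B))))"
    proof (intro sum_mono janson_inequality)
      fix z
      show "\<Delta> (patch H z x) \<le> B"
        using \<Delta>[of "patch H z x"] mult_right_mono[OF rej_le_1[of "patch H z x"], of B] B by linarith
    qed (use g B in auto)
    also have "\<dots> = real (card \<Sigma> ^ card H) * exp (- (g\<^sup>2 / (8 * B)))"
      using finH by (simp add: card_PiE power_divide)
    also have "\<dots> \<le> 1 / 3" by (rule union)
    finally show "2 / 3 \<le> measure_pmf.prob (random_subset n p) {W. \<not> A W (restrict x W)}"
      using measure_pmf.prob_compl[of "{W. A W (restrict x W)}" "random_subset n p"]
      by (simp add: Compl_eq_Diff_UNIV[symmetric] Collect_neg_eq)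
  qed
  then show ?thesis by blast
qed

section \<open>Choice of the level and of the constants\<close>

lemma sampling_tester_of_query_tester:
  fixes T :: "'a local_test pmf" and \<Sigma> :: "'a set" and \<alpha> \<gamma> N :: real and c n :: nat
  defines "K \<equiv> 3 * \<gamma> + 2 * ln (3 * real (card \<Sigma>))"
  assumes n: "0 < n" and N: "1 \<le> N" "N ^ c = real n" "2 / \<epsilon> \<le> N" "\<alpha> \<le> N"
    and \<epsilon>: "0 < \<epsilon>" and \<gamma>: "0 \<le> \<gamma>" and d: "0 < d" and c: "0 < c"
    and g: "0 < g" "\<delta> - d / real c = \<gamma> + g"
    and \<alpha>: "\<alpha> = 1 + 4 * d / g\<^sup>2 * K"
    and finite: "finite \<Sigma>" "\<Sigma> \<noteq> {}" and P: "P \<subseteq> words n \<Sigma>"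
    and T: "nonadaptive_tester n T" "avg_query_complexity T = d"
    and complete: "\<And>x. x \<in> P \<Longrightarrow> rejection_prob T x \<le> \<gamma>"
    and sound: "\<And>x. x \<in> words n \<Sigma> \<Longrightarrow> far n (\<epsilon> / 2) x P \<Longrightarrow> \<delta> \<le> rejection_prob T x"
  shows "\<exists>A. sampling_tester n \<Sigma> (\<alpha> / N) \<epsilon> P A"
proof -
  have s: "1 \<le> real (card \<Sigma>)"
    using finite by (simp add: Suc_le_eq card_gt_0_iff)
  have ln3s: "0 < ln (3 * real (card \<Sigma>))" using s by simp
  have K: "0 < K" using ln3s \<gamma> by (simp add: K_def)
  have \<alpha>1: "1 < \<alpha>" using K d g by (simp add: \<alpha>)
  have fin: "finite (set_pmf T)" and Q: "\<And>t. t \<in> set_pmf T \<Longrightarrow> fst t \<subseteq> {..<n}"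
    using T(1) unfolding nonadaptive_tester_def by fastforce+
  have finQ: "finite (fst t)" if "t \<in> set_pmf T" for t
    using Q[OF that] finite_subset by blast
  have d_eq: "(\<Sum>t\<in>set_pmf T. pmf T t * real (card (fst t))) = d"
    using T(2) by (simp add: avg_query_complexity_eq_sum[OF fin])

  define D where "D i = (\<Sum>t\<in>{t \<in> set_pmf T. i \<in> fst t}. pmf T t)" for i
  define \<theta> where "\<theta> k = d / N ^ k" for k :: nat
  have \<theta>_pos: "0 < \<theta> k" for k using d N by (simp add: \<theta>_def)
  have "decseq \<theta>"
    unfolding \<theta>_def decseq_def using d N by (auto intro!: divide_left_mono power_increasing)
  from ex_uncrowded_level[where \<mu> = "pmf T" and D = D and Q = fst, OF fin _ finQ this c]
  obtain j where j: "j < c" "(\<Sum>t\<in>set_pmf T. pmf T t * of_bool (crowded D \<theta> (fst t) j)) \<le> d / real c"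
    unfolding d_eq by auto

  define H where "H = {i. i < n \<and> \<theta> j < D i}"
  define G where "G = {t \<in> set_pmf T. \<not> crowded D \<theta> (fst t) j}"
  \<comment> \<open>Double counting: the degrees add up to \<open>d\<close>, so at most
    \<open>N ^ j\<close> of them exceed \<open>d / N ^ j\<close>.\<close>
  have "(\<Sum>i\<in>H. \<theta> j) \<le> (\<Sum>i\<in>H. D i)"
    by (intro sum_mono) (auto simp: H_def)
  also have "\<dots> \<le> (\<Sum>i<n. D i)"
    by (intro sum_mono2) (auto simp: H_def D_def intro!: sum_nonneg)
  also have "\<dots> = (\<Sum>i<n. \<Sum>t\<in>set_pmf T. pmf T t * of_bool (i \<in> fst t))"
    unfolding D_def by (simp add: sum.inter_filter[OF fin] of_bool_def if_distrib cong: if_cong)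
  also have "\<dots> = (\<Sum>t\<in>set_pmf T. pmf T t * (\<Sum>i<n. of_bool (i \<in> fst t)))"
    by (subst sum.swap) (simp only: sum_distrib_left)
  also have "\<dots> = (\<Sum>t\<in>set_pmf T. pmf T t * real (card (fst t)))"
  proof (intro sum.cong refl)
    fix t assume "t \<in> set_pmf T"
    from Q[OF this] have "{..<n} \<inter> fst t = fst t" by auto
    then show "pmf T t * (\<Sum>i<n. of_bool (i \<in> fst t)) = pmf T t * real (card (fst t))" by simp
  qed
  finally have "real (card H) * \<theta> j \<le> d"
    by (simp add: d_eq)
  then have card_H: "real (card H) \<le> N ^ j"
    using d N by (simp add: \<theta>_def field_simps)
  \<comment> \<open>Since \<open>j < c\<close>, a factor \<open>N \<ge> 2 / \<epsilon>\<close> is to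
    spare, which makes \<open>H\<close> small enough for \<open>far_patch\<close>.\<close>
  have "N ^ j * N \<le> N ^ c"
    using j N power_increasing[of "Suc j" c N] by (simp add: mult.commute)
  then have "N ^ j \<le> real n / N"
    using N by (simp add: pos_le_divide_eq)
  also have "\<dots> \<le> real n / (2 / \<epsilon>)"
    using N \<epsilon> by (intro divide_left_mono) auto
  finally have card_H_le: "real (card H) \<le> \<epsilon> / 2 * real n"
    using card_H by (simp add: mult.commute)

  \<comment> \<open>This is the bound of \<open>overlap_weight_le\<close> with ratio
    \<open>x = 1 / \<alpha>\<close>, for which \<open>x * p = 1 / N\<close> is the step between
    successive thresholds.\<close>
  define B where "B = \<theta> j * ((1 / \<alpha>) / (1 - 1 / \<alpha>))"
  have "(1 / \<alpha>) / (1 - 1 / \<alpha>) = 1 / (\<alpha> - 1)"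
    using \<alpha>1 by (simp add: field_simps)
  then have B: "B = g\<^sup>2 / (4 * N ^ j * K)"
    using d g K N by (simp add: B_def \<theta>_def \<alpha> field_simps)
  have NK: "K \<le> N ^ j * K"
    using N K by (simp add: one_le_power)
  show ?thesis
  proof (rule sampling_tester_if_overlap_le[where T = T and G = G and H = H and B = B and \<gamma> = \<gamma> and g = g])
    show "0 < \<alpha> / N" "\<alpha> / N \<le> 1" using \<alpha>1 N by auto
    show "G \<subseteq> set_pmf T" "H \<subseteq> {..<n}" by (auto simp: G_def H_def)
    show "0 < B" using B g K N by simp
  next
    fix t assume t: "t \<in> G"
    then have tT: "t \<in> set_pmf T" by (simp add: G_def)
    have light: "fst t - H = {i \<in> fst t. D i \<le> \<theta> j}"
      using Q[OF tT] by (auto simp: H_def)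
    show "(\<Sum>u\<in>{u \<in> G. (fst t - H) \<inter> (fst u - H) \<noteq> {}}.
        pmf T u / (\<alpha> / N) ^ card ((fst t - H) \<inter> (fst u - H))) \<le> B"
      unfolding B_def
    proof (rule overlap_weight_le[where D = D])
      show "finite G" using fin by (simp add: G_def)
      show "finite (fst t - H)" using finQ[OF tT] by simp
      show "0 < \<alpha> / N" "\<alpha> / N \<le> 1" "0 \<le> 1 / \<alpha>" "1 / \<alpha> < 1" using \<alpha>1 N by auto
      show "(\<Sum>u\<in>{u \<in> G. i \<in> fst u - H}. pmf T u) \<le> D i" for i
        unfolding D_def using fin by (intro sum_mono2) (auto simp: G_def)
      show "0 \<le> \<theta> j" using \<theta>_pos[of j] by simp
    next
      fix i assume i: "i \<in> fst t - H"
      define m where "m = card {k \<in> fst t - H. D i \<le> D k}"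
      have "i \<in> {k \<in> fst t - H. D i \<le> D k}" using i by simp
      then have m: "1 \<le> m"
        using finQ[OF tT] unfolding m_def by (auto simp: Suc_le_eq card_gt_0_iff)
      \<comment> \<open>Otherwise the \<open>m\<close> light queries of degree at least
        \<open>D i\<close> all lie in the window of length \<open>m\<close>, and \<open>t\<close>
        would be crowded.\<close>
      have "D i \<le> \<theta> (j + m)"
      proof (rule ccontr)
        assume "\<not> ?thesis"
        then have "m \<le> card {k \<in> fst t. \<theta> (j + m) < D k \<and> D k \<le> \<theta> j}"
          unfolding m_def[unfolded light] light
          using finQ[OF tT] by (intro card_mono) auto
        with m have "crowded D \<theta> (fst t) j" by (auto simp: crowded_def)
        with t show False by (simp add: G_def)
      qed
      also have "\<dots> = \<theta> j * (1 / \<alpha> * (\<alpha> / N)) ^ m"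
        using \<alpha>1 N by (simp add: \<theta>_def power_add power_divide)
      finally show "D i \<le> \<theta> j * (1 / \<alpha> * (\<alpha> / N)) ^ card {k \<in> fst t - H. D i \<le> D k}"
        by (simp add: m_def)
    qed simp
  next
    fix x assume x: "x \<in> P"
    have "(\<Sum>t\<in>G. pmf T t * of_bool (snd t (restrict x (fst t)))) \<le> rejection_prob T x"
      unfolding rejection_prob_eq_sum[OF fin] using fin
      by (intro sum_mono2) (auto simp: G_def)
    with complete[OF x] show "(\<Sum>t\<in>G. pmf T t * of_bool (snd t (restrict x (fst t)))) \<le> \<gamma>"
      by simp
  next
    fix x assume x: "x \<in> words n \<Sigma>" "far n (\<epsilon> / 2) x P"
    \<comment> \<open>Discarding the crowded tests costs at most \<open>d / c\<close> of the
      rejection probability.\<close>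
    have "rejection_prob T x \<le> (\<Sum>t\<in>set_pmf T. pmf T t * of_bool (crowded D \<theta> (fst t) j) +
        (if \<not> crowded D \<theta> (fst t) j then pmf T t * of_bool (snd t (restrict x (fst t))) else 0))"
      unfolding rejection_prob_eq_sum[OF fin] by (intro sum_mono) auto
    also have "\<dots> = (\<Sum>t\<in>set_pmf T. pmf T t * of_bool (crowded D \<theta> (fst t) j)) +
        (\<Sum>t\<in>G. pmf T t * of_bool (snd t (restrict x (fst t))))"
      unfolding G_def sum.distrib sum.inter_filter[OF fin] ..
    finally show "\<gamma> + g \<le> (\<Sum>t\<in>G. pmf T t * of_bool (snd t (restrict x (fst t))))"
      using sound[OF x] j(2) g(2) by linarith
  next
    \<comment> \<open>The summand \<open>3 * \<gamma>\<close> of \<open>K\<close> is made for this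
      estimate.\<close>
    have "4 * (\<gamma> * B) / g\<^sup>2 = \<gamma> / (N ^ j * K)"
      using g by (simp add: B field_simps)
    also have "\<dots> \<le> \<gamma> / K"
      using NK K \<gamma> by (intro divide_left_mono) auto
    also have "\<dots> \<le> 1 / 3"
      using K ln3s \<gamma> by (simp add: K_def field_simps)
    finally show "4 * (\<gamma> * B) / g\<^sup>2 \<le> 1 / 3" .
  next
    have "real (card \<Sigma> ^ card H) = exp (real (card H) * ln (real (card \<Sigma>)))"
      using s by (simp add: exp_of_nat_mult)
    also have "\<dots> \<le> exp (N ^ j * ln (real (card \<Sigma>)))"
      using s card_H by (simp add: mult_right_mono)
    finally have 1: "real (card \<Sigma> ^ card H) \<le> exp (N ^ j * ln (real (card \<Sigma>)))" .
    \<comment> \<open>The other summand of \<open>K\<close> gives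
      \<open>exp (- (N ^ j * ln (3 * real (card \<Sigma>))))\<close>, which beats the number of
      guesses by a factor \<open>3\<close> to the \<open>N ^ j\<close>.\<close>
    have "g\<^sup>2 / (8 * B) = N ^ j * K / 2"
      using g K N by (simp add: B field_simps)
    moreover have "N ^ j * (2 * ln (3 * real (card \<Sigma>))) \<le> N ^ j * K"
      using N \<gamma> by (intro mult_left_mono) (auto simp: K_def)
    ultimately have 2: "exp (- (g\<^sup>2 / (8 * B))) \<le> exp (- (N ^ j * ln (3 * real (card \<Sigma>))))"
      by simp
    have "real (card \<Sigma> ^ card H) * exp (- (g\<^sup>2 / (8 * B))) \<le>
        exp (N ^ j * ln (real (card \<Sigma>))) * exp (- (N ^ j * ln (3 * real (card \<Sigma>))))"
      using 1 2 by (intro mult_mono) auto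
    also have "\<dots> = exp (- (N ^ j * ln 3))"
      using s by (simp add: exp_add[symmetric] ln_mult algebra_simps)
    also have "\<dots> \<le> exp (- ln 3)"
      using N by (simp add: one_le_power)
    also have "\<dots> = 1 / 3" by (simp add: exp_minus)
    finally show "real (card \<Sigma> ^ card H) * exp (- (g\<^sup>2 / (8 * B))) \<le> 1 / 3" .
  qed (use n finite P T g card_H_le in auto)
qed

theorem theorem1p2:
  fixes s :: nat and \<epsilon> \<gamma> \<delta> d \<beta> g \<alpha>\<^sub>w\<^sub>t :: real and c :: int
  assumes "0 < \<epsilon>" and "\<epsilon> \<le> 1"
    and "0 \<le> \<gamma>" and "\<gamma> < \<delta>" and "\<delta> \<le> 1"
    and "d > 0"
    and "real_of_int c > d / (\<delta> - \<gamma>)"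
    and "\<beta> = \<delta> - d / real_of_int c"
    and "g = \<beta> - \<gamma>"
    and "\<alpha>\<^sub>w\<^sub>t = 1 + 4 * d / g\<^sup>2 * (3 * \<gamma> + 2 * ln (3 * real s))"
  shows "g > 0 \<and>
    (\<exists>n\<^sub>0 :: nat. \<forall>n \<ge> n\<^sub>0. \<forall>(\<Sigma> :: 'a set) P (T :: 'a local_test pmf).
       finite \<Sigma> \<and> card \<Sigma> = s \<and> P \<subseteq> words n \<Sigma> \<and>
       nonadaptive_tester n T \<and> avg_query_complexity T = d \<and>
       (\<forall>x\<in>P. rejection_prob T x \<le> \<gamma>) \<and>
       (\<forall>x\<in>words n \<Sigma>. far n (\<epsilon> / 2) x P \<longrightarrow> rejection_prob T x \<ge> \<delta>) \<longrightarrow>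
       (let p = \<alpha>\<^sub>w\<^sub>t * real n powr (- 1 / real_of_int c) in
          p \<le> 1 \<and>
          (\<exists>A. sampling_tester n \<Sigma> p \<epsilon> P A) \<and>
          expected_sample_complexity n p = \<alpha>\<^sub>w\<^sub>t * real n powr (1 - 1 / real_of_int c)))"
proof
  have c_pos: "0 < real_of_int c"
    using assms(4,6,7) by (smt (verit) divide_pos_pos)
  then have "d / real_of_int c < \<delta> - \<gamma>"
    using assms(4,7) by (simp add: divide_less_eq mult.commute)
  then show g: "g > 0"
    using assms(8,9) by simp
  obtain c' where c': "c = int c'" "0 < c'"
    using c_pos zero_less_imp_eq_int by auto
  have \<alpha>: "1 \<le> \<alpha>\<^sub>w\<^sub>t"
  proof -
    \<comment> \<open>For \<open>s = 0\<close> this rests on the convention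
      \<open>ln 0 = 0\<close>.\<close>
    have "0 \<le> ln (3 * real s)" by (cases s) auto
    then show ?thesis using assms by simp
  qed
  \<comment> \<open>Once \<open>n \<ge> m ^ c'\<close>, the root \<open>N\<close> is at least
    \<open>m\<close>: the first entry gives \<open>p \<le> 1\<close>, the second makes
    \<open>H\<close> small.\<close>
  define m where "m = max \<alpha>\<^sub>w\<^sub>t (2 / \<epsilon>)"
  have m: "1 \<le> m" using \<alpha> by (simp add: m_def)
  obtain n\<^sub>0 :: nat where n\<^sub>0: "m ^ c' \<le> real n\<^sub>0"
    using real_arch_simple by blast
  show "\<exists>n\<^sub>0 :: nat. \<forall>n \<ge> n\<^sub>0. \<forall>(\<Sigma> :: 'a set) P (T :: 'a local_test pmf).
       finite \<Sigma> \<and> card \<Sigma> = s \<and> P \<subseteq> words n \<Sigma> \<and>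
       nonadaptive_tester n T \<and> avg_query_complexity T = d \<and>
       (\<forall>x\<in>P. rejection_prob T x \<le> \<gamma>) \<and>
       (\<forall>x\<in>words n \<Sigma>. far n (\<epsilon> / 2) x P \<longrightarrow> rejection_prob T x \<ge> \<delta>) \<longrightarrow>
       (let p = \<alpha>\<^sub>w\<^sub>t * real n powr (- 1 / real_of_int c) in
          p \<le> 1 \<and>
          (\<exists>A. sampling_tester n \<Sigma> p \<epsilon> P A) \<and>
          expected_sample_complexity n p = \<alpha>\<^sub>w\<^sub>t * real n powr (1 - 1 / real_of_int c))"
  proof (intro exI[of _ n\<^sub>0] allI impI)
    fix n \<Sigma> P and T :: "'a local_test pmf"
    assume n: "n\<^sub>0 \<le> n" and *: "finite \<Sigma> \<and> card \<Sigma> = s \<and> P \<subseteq> words n \<Sigma> \<and>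
       nonadaptive_tester n T \<and> avg_query_complexity T = d \<and>
       (\<forall>x\<in>P. rejection_prob T x \<le> \<gamma>) \<and>
       (\<forall>x\<in>words n \<Sigma>. far n (\<epsilon> / 2) x P \<longrightarrow> rejection_prob T x \<ge> \<delta>)"
    define N where "N = real n powr (1 / real c')"
    have mn: "m ^ c' \<le> real n" using n\<^sub>0 n by linarith
    have "0 < m ^ c'" using m by simp
    then have n_pos: "0 < real n" using mn by linarith
    have Nc: "N ^ c' = real n"
      using n_pos c' by (simp add: N_def powr_realpow[symmetric] powr_powr)
    have "m \<le> N"
      using mn m c' power_mono_iff[of m N c'] unfolding Nc by (simp add: N_def)
    then have N: "1 \<le> N" "\<alpha>\<^sub>w\<^sub>t \<le> N" "2 / \<epsilon> \<le> N"
      using m by (auto simp: m_def)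
    have p: "\<alpha>\<^sub>w\<^sub>t * real n powr (- 1 / real_of_int c) = \<alpha>\<^sub>w\<^sub>t / N"
      using powr_minus_divide[of "real n" "1 / real c'"] by (simp add: c' N_def)
    have p01: "0 \<le> \<alpha>\<^sub>w\<^sub>t / N" "\<alpha>\<^sub>w\<^sub>t / N \<le> 1"
      using N \<alpha> by auto
    have tester: "\<exists>A. sampling_tester n \<Sigma> (\<alpha>\<^sub>w\<^sub>t / N) \<epsilon> P A"
    \<comment> \<open>Over the empty alphabet there are no words, as \<open>n > 0\<close>, and any
      post-processing will do.\<close>
    proof (cases "\<Sigma> = {}")
      case True
      then have "words n \<Sigma> = {}" using n_pos by (auto simp: words_def PiE_eq_empty_iff)
      with * p01 show ?thesis by (auto simp: sampling_tester_def)
    next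
      case False
      show ?thesis
        using * assms False N n_pos Nc c' g
        by (intro sampling_tester_of_query_tester[where c = c' and \<gamma> = \<gamma> and \<delta> = \<delta> and d = d and g = g and T = T]) auto
    qed
    have "expected_sample_complexity n (\<alpha>\<^sub>w\<^sub>t / N) = real n * (\<alpha>\<^sub>w\<^sub>t / N)"
      by (rule expected_sample_complexity_eq[OF p01])
    also have "\<dots> = \<alpha>\<^sub>w\<^sub>t * real n powr (1 - 1 / real_of_int c)"
      using n_pos by (simp add: c' N_def powr_diff)
    finally show "let p = \<alpha>\<^sub>w\<^sub>t * real n powr (- 1 / real_of_int c) in
          p \<le> 1 \<and>
          (\<exists>A. sampling_tester n \<Sigma> p \<epsilon> P A) \<and>
          expected_sample_complexity n p = \<alpha>\<^sub>w\<^sub>t * real n powr (1 - 1 / real_of_int c)"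
      unfolding Let_def p using p01 tester by blast
  qed
qed

end
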